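(* Let $\mathcal{H}$ be finite-dimensional, $\mathscr{A}\subseteq\mathfrak{B}(\mathcal{H})$ a $*$-subalgebra, $\mathcal{L}:\mathscr{A}\to\mathscr{A}$ a Lindblad generator, $\mathfrak{S}\subseteq\mathfrak{D}(\mathcal{H})\cap\mathscr{A}$ a set of initial states, and $\mathscr{R}=\mathrm{span}\{e^{\mathcal{L}t}(\rho_0):t\ge0,\rho_0\in\mathfrak{S}\}$ the reachable subspace. Let $\mathscr{V}$ be an operator subspace with $\mathscr{R}\subseteq\mathscr{V}$, let $\Pi_{\mathscr{V}}$ be a (not necessarily orthogonal) projection superoperator onto $\mathscr{V}$, and let $\mathcal{R},\mathcal{J}$ be full-rank factors of $\Pi_\mathscr{V}$, i.e. $\mathcal{R}$ maps onto a space $\mathcal{X}$ with $\dim\mathcal{X}=\dim\mathscr{V}$, $\mathcal{J}:\mathcal{X}\to\mathscr{V}$, $\mathcal{J}\mathcal{R}=\Pi_\mathscr{V}$ and $\mathcal{R}\mathcal{J}=\mathcal{I}$ (identity on $\mathcal{X}$). Define $\mathcal{F}_L\equiv\mathcal{R}\mathcal{L}\mathcal{J}$. Then $$e^{\mathcal{L}t}(\rho_0)=\mathcal{J}e^{\mathcal{F}_Lt}\mathcal{R}(\rho_0)\qquad\forall t\ge0,\ \forall\rho_0\in\mathfrak{S}.$$ Moreover, $\mathscr{V}=\mathscr{R}$ is an operator subspace of minimal dimension for which this identity holds.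
   Context: A Lindblad generator has the form $\mathcal{L}(\rho)=-i[H,\rho]+\sum_u\big(L_u\rho L_u^\dagger-\tfrac12\{L_u^\dagger L_u,\rho\}\big)$ with $H=H^\dagger$. $\mathfrak{D}(\mathcal{H})$ is the set of density operators on $\mathcal{H}$. A projection superoperator is an idempotent linear map on the operator space with image $\mathscr{V}$. *)

theory Defs
  imports "HOL-Analysis.Analysis"
begin

text \<open>Operators on the finite-dimensional Hilbert space H = complex^'n are the
  complex matrices complex^'n^'n.  Superoperators are maps on this type.\<close>

type_synonym 'n op = "complex^'n^'n"

definition cscale :: "complex \<Rightarrow> 'n::finite op \<Rightarrow> 'n op" where
  "cscale c A = (\<chi> i j. c * A $ i $ j)"

definition adj :: "'n::finite op \<Rightarrow> 'n op" where
  "adj A = (\<chi> i j. cnj (A $ j $ i))"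

definition mtrace :: "'n::finite op \<Rightarrow> complex" where
  "mtrace A = (\<Sum>i\<in>UNIV. A $ i $ i)"

definition psd :: "'n::finite op \<Rightarrow> bool" where
  "psd A \<longleftrightarrow> (\<forall>x::complex^'n. (\<Sum>i\<in>UNIV. cnj (x $ i) * (A *v x) $ i) \<in> \<real>
                 \<and> 0 \<le> Re (\<Sum>i\<in>UNIV. cnj (x $ i) * (A *v x) $ i))"

text \<open>The set of density operators D(H).\<close>
definition density_ops :: "'n::finite op set" where
  "density_ops = {\<rho>. psd \<rho> \<and> mtrace \<rho> = 1}"

text \<open>Lindblad generator (finitely many jump operators, H Hermitian).\<close>
definition is_lindblad :: "('n::finite op \<Rightarrow> 'n op) \<Rightarrow> bool" where
  "is_lindblad L \<longleftrightarrow> (\<exists>(H::'n op) (Ls::'n op list). adj H = H \<and>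
     (\<forall>\<rho>. L \<rho> = cscale (- \<i>) (H ** \<rho> - \<rho> ** H)
        + sum_list (map (\<lambda>Lu. Lu ** \<rho> ** adj Lu
              - cscale (1/2) (adj Lu ** Lu ** \<rho> + \<rho> ** (adj Lu ** Lu))) Ls)))"

text \<open>*-subalgebra of B(H): complex subspace closed under products and adjoints.\<close>
definition star_subalgebra :: "'n::finite op set \<Rightarrow> bool" where
  "star_subalgebra A \<longleftrightarrow> module.subspace cscale A
     \<and> (\<forall>x\<in>A. \<forall>y\<in>A. x ** y \<in> A) \<and> (\<forall>x\<in>A. adj x \<in> A)"

text \<open>Exponential e^{t f} of a (linear) map f, via the exponential series.\<close>
definition lexp :: "real \<Rightarrow> ('a::real_normed_vector \<Rightarrow> 'a) \<Rightarrow> 'a \<Rightarrow> 'a" where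
  "lexp t f x = (\<Sum>n. (t ^ n / fact n) *\<^sub>R (f ^^ n) x)"

text \<open>Reachable subspace span{e^{Lt} rho0 : t >= 0, rho0 in S} (complex span).\<close>
definition reach :: "('n::finite op \<Rightarrow> 'n op) \<Rightarrow> 'n op set \<Rightarrow> 'n op set" where
  "reach L S = module.span cscale {lexp t L \<rho>0 | t \<rho>0. t \<ge> 0 \<and> \<rho>0 \<in> S}"

text \<open>Pi is a (not necessarily orthogonal) projection superoperator onto V, and
  R : B(H) -> X = complex^'k, J : X -> V are full-rank factors of Pi.\<close>
definition proj_factors ::
  "'n::finite op set \<Rightarrow> ('n op \<Rightarrow> 'n op) \<Rightarrow> ('n op \<Rightarrow> complex^'k::finite)
     \<Rightarrow> (complex^'k \<Rightarrow> 'n op) \<Rightarrow> bool" where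
  "proj_factors V P R J \<longleftrightarrow>
     module.subspace cscale V
   \<and> Vector_Spaces.linear cscale cscale P \<and> P \<circ> P = P \<and> range P = V
   \<and> Vector_Spaces.linear cscale (*s) R \<and> Vector_Spaces.linear (*s) cscale J
   \<and> surj R \<and> CARD('k) = vector_space.dim cscale V
   \<and> range J \<subseteq> V \<and> J \<circ> R = P \<and> R \<circ> J = id"

end

theory Submission
  imports Defs
begin

text \<open>If the trajectory \<open>e\<^bsup>tL\<^esup> \<rho>\<^sub>0\<close> stays in a subspace \<open>V\<close> for all \<open>t \<ge> 0\<close>, then so do all
  Krylov vectors \<open>L\<^sup>n \<rho>\<^sub>0\<close>: the component of the trajectory orthogonal to \<open>V\<close> is a power
  series in \<open>t\<close> vanishing on \<open>(0, \<infinity>)\<close>, so all its coefficients vanish.  Since \<open>\<J>\<R>\<close> is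
  the identity on \<open>V\<close>, induction gives \<open>\<J> F\<^sub>L\<^sup>n \<R> \<rho>\<^sub>0 = L\<^sup>n \<rho>\<^sub>0\<close>, and summing the exponential
  series yields the reduced dynamics.  Conversely, any exact reduced model through
  \<open>\<J>' : \<complex>\<^sup>m \<rightarrow> B(H)\<close> keeps every trajectory in the range of \<open>\<J>'\<close>, whose dimension is at
  most \<open>m = dim V'\<close>.\<close>

lemma scaleR_eq_cscale: "r *\<^sub>R (A::'n::finite op) = cscale (complex_of_real r) A"
  by (simp add: cscale_def vec_eq_iff) (simp add: scaleR_conv_of_real)

lemma scaleR_eq_vector_scalar_mult: "r *\<^sub>R (x::complex^'k::finite) = complex_of_real r *s x"
  by (simp add: vec_eq_iff) (simp add: scaleR_conv_of_real)

lemma module_cscale: "module (cscale :: complex \<Rightarrow> 'n::finite op \<Rightarrow> 'n op)"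
  unfolding module_def cscale_def by (simp add: vec_eq_iff algebra_simps)

lemma vector_space_cscale: "vector_space (cscale :: complex \<Rightarrow> 'n::finite op \<Rightarrow> 'n op)"
  using module_cscale module_iff_vector_space by blast

lemma subspace_if_cscale_subspace: "module.subspace cscale (V::'n::finite op set) \<Longrightarrow> subspace V"
  unfolding subspace_def module.subspace_def[OF module_cscale]
  by (simp add: scaleR_eq_cscale)

lemma linear_if_complex_linear:
  fixes f :: "'a::real_vector \<Rightarrow> 'b::real_vector"
  assumes "Vector_Spaces.linear s\<^sub>1 s\<^sub>2 f"
    and "\<And>r x. s\<^sub>1 (complex_of_real r) x = r *\<^sub>R x"
    and "\<And>r y. s\<^sub>2 (complex_of_real r) y = r *\<^sub>R y"
  shows "linear f"
proof (rule linearI)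
  show "f (x + y) = f x + f y" for x y
    using assms(1) by (simp add: linear_iff_module_hom module_hom.add)
  show "f (r *\<^sub>R x) = r *\<^sub>R f x" for r x
    using assms by (metis linear_iff_module_hom module_hom.scale)
qed

lemma linear_matrix_mult_left: "linear f \<Longrightarrow> linear (\<lambda>x. (A::'n::finite op) ** f x)"
  by (rule linearI)
    (simp_all add: linear_add linear_scale vec_eq_iff
      matrix_matrix_mult_def distrib_left sum.distrib scaleR_sum_right)

lemma linear_matrix_mult_right: "linear f \<Longrightarrow> linear (\<lambda>x. f x ** (A::'n::finite op))"
  by (rule linearI)
    (simp_all add: linear_add linear_scale vec_eq_iff matrix_matrix_mult_def
      distrib_right sum.distrib scaleR_sum_right)

lemma linear_cscale: "linear f \<Longrightarrow> linear (\<lambda>x. cscale c (f x :: 'n::finite op))"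
  by (rule linearI) (simp_all add: linear_add linear_scale cscale_def vec_eq_iff algebra_simps)

lemma linear_sum_list: "(\<And>u. linear (g u)) \<Longrightarrow> linear (\<lambda>x. sum_list (map (\<lambda>u. g u x) us))"
  by (induction us) (simp_all add: linear_zero linear_compose_add)

lemma lindblad_linear:
  assumes "is_lindblad L"
  shows "linear L"
proof -
  obtain H Ls where "L = (\<lambda>\<rho>. cscale (- \<i>) (H ** \<rho> - \<rho> ** H)
        + sum_list (map (\<lambda>Lu. Lu ** \<rho> ** adj Lu
              - cscale (1/2) (adj Lu ** Lu ** \<rho> + \<rho> ** (adj Lu ** Lu))) Ls))"
    using assms unfolding is_lindblad_def by fast
  then show ?thesis
    by (simp only:) (intro linear_compose_add linear_compose_sub linear_cscale
        linear_sum_list linear_matrix_mult_left linear_matrix_mult_right linear_ident)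
qed

lemma lexp_summable:
  fixes f :: "'a::banach \<Rightarrow> 'a"
  assumes "bounded_linear f"
  shows "summable (\<lambda>n. (t ^ n / fact n) *\<^sub>R (f ^^ n) x)"
proof -
  obtain K where K: "K > 0" "\<And>x. norm (f x) \<le> norm x * K"
    using bounded_linear.pos_bounded[OF assms] by blast
  have norm_funpow: "norm ((f ^^ n) x) \<le> norm x * K ^ n" for n
  proof (induction n)
    case (Suc n)
    have "norm ((f ^^ Suc n) x) \<le> norm ((f ^^ n) x) * K" using K(2) by simp
    also have "\<dots> \<le> norm x * K ^ n * K" using Suc K(1) by (simp add: mult_right_mono)
    finally show ?case by (simp add: algebra_simps)
  qed simp
  show ?thesis
  proof (rule summable_comparison_test'[OF summable_mult[OF summable_exp]])
    fix n :: nat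
    have "norm ((t ^ n / fact n) *\<^sub>R (f ^^ n) x) = \<bar>t\<bar> ^ n / fact n * norm ((f ^^ n) x)"
      by (simp add: power_abs)
    also have "\<dots> \<le> \<bar>t\<bar> ^ n / fact n * (norm x * K ^ n)"
      by (intro mult_left_mono norm_funpow) auto
    also have "\<dots> = norm x * (inverse (fact n) * (\<bar>t\<bar> * K) ^ n)"
      by (simp add: power_mult_distrib divide_inverse mult_ac)
    finally show "norm ((t ^ n / fact n) *\<^sub>R (f ^^ n) x) \<le> norm x * (inverse (fact n) * (\<bar>t\<bar> * K) ^ n)" .
  qed
qed

lemma powser_coeff_0_eq_0_if_zero_on_pos:
  fixes a :: "nat \<Rightarrow> real"
  assumes "\<And>x. summable (\<lambda>n. a n * x ^ n)"
    and "\<And>x. x > 0 \<Longrightarrow> (\<Sum>n. a n * x ^ n) = 0"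
  shows "a 0 = 0"
proof -
  define g where "g x = (\<Sum>n. a n * x ^ n)" for x :: real
  have "(g \<longlongrightarrow> g 0) (at_right 0)"
    using isCont_powser_converges_everywhere[OF assms(1)]
    unfolding g_def isCont_def by (rule tendsto_mono[OF at_le[OF subset_UNIV]])
  moreover have "eventually (\<lambda>x. g x = 0) (at_right 0)"
    unfolding g_def using eventually_mono[OF eventually_at_right_less assms(2)] .
  ultimately have "((\<lambda>_. 0) \<longlongrightarrow> g 0) (at_right (0::real))"
    by (rule Lim_transform_eventually)
  then have "g 0 = 0"
    using tendsto_unique[OF trivial_limit_at_right_real _ tendsto_const] by blast
  then show ?thesis unfolding g_def using powser_zero[of a] by simp
qed

lemma powser_coeffs_eq_0_if_zero_on_pos:
  fixes a :: "nat \<Rightarrow> real"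
  assumes "\<And>x. summable (\<lambda>n. a n * x ^ n)"
    and "\<And>x. x > 0 \<Longrightarrow> (\<Sum>n. a n * x ^ n) = 0"
  shows "a n = 0"
  using assms
proof (induction n arbitrary: a)
  case 0
  then show ?case by (rule powser_coeff_0_eq_0_if_zero_on_pos)
next
  case (Suc n)
  have "a 0 = 0" using powser_coeff_0_eq_0_if_zero_on_pos Suc.prems by blast
  have "(\<Sum>n. a (Suc n) * x ^ n) = 0" if "x > 0" for x
  proof -
    have "(\<Sum>n. a (Suc n) * x ^ n) * x = 0"
      using powser_split_head(2)[OF Suc.prems(1)[of x]] Suc.prems(2)[OF that] \<open>a 0 = 0\<close> by simp
    then show ?thesis using that by simp
  qed
  then show ?case
    using Suc.IH[of "\<lambda>n. a (Suc n)"] powser_split_head(3)[OF Suc.prems(1)] by blast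
qed

lemma funpow_mem_subspace_if_lexp_mem:
  fixes L :: "'a::euclidean_space \<Rightarrow> 'a"
  assumes "linear L" and "subspace V" and "\<And>t. t \<ge> 0 \<Longrightarrow> lexp t L x \<in> V"
  shows "(L ^^ n) x \<in> V"
proof -
  have L: "bounded_linear L" using assms(1) linear_conv_bounded_linear by blast
  obtain y z where y: "y \<in> span V" and z: "\<And>w. w \<in> span V \<Longrightarrow> orthogonal z w"
      and decomp: "(L ^^ n) x = y + z"
    using orthogonal_subspace_decomp_exists[of V "(L ^^ n) x"] by blast
  define a where "a m = (z \<bullet> (L ^^ m) x) / fact m" for m
  have term_eq: "z \<bullet> ((t ^ m / fact m) *\<^sub>R (L ^^ m) x) = a m * t ^ m" for t m
    by (simp add: a_def)
  have sums: "(\<lambda>m. a m * t ^ m) sums (z \<bullet> lexp t L x)" for t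
    using bounded_linear.sums[OF bounded_linear_inner_right summable_sums[OF lexp_summable[OF L]]]
    unfolding lexp_def term_eq[symmetric] by simp
  have "z \<bullet> lexp t L x = 0" if "t > 0" for t
    using z[OF span_base[OF assms(3)]] that by (simp add: orthogonal_def)
  then have "a n = 0"
    using powser_coeffs_eq_0_if_zero_on_pos[of a] sums sums_summable sums_unique by metis
  then have "z \<bullet> (L ^^ n) x = 0" by (simp add: a_def)
  moreover have "z \<bullet> y = 0" using z[OF y] by (simp add: orthogonal_def inner_commute)
  ultimately have "z = 0" using decomp by (simp add: inner_add_right)
  then show ?thesis using decomp y assms(2) by (metis add.right_neutral span_eq_iff)
qed

lemma lexp_factorization:
  fixes L :: "'a::euclidean_space \<Rightarrow> 'a" and R :: "'a \<Rightarrow> 'b::euclidean_space" and J :: "'b \<Rightarrow> 'a"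
  assumes "linear L" "linear R" "linear J" "subspace V"
    and "\<And>s. s \<ge> 0 \<Longrightarrow> lexp s L x \<in> V" and "\<And>v. v \<in> V \<Longrightarrow> J (R v) = v"
  shows "lexp t L x = J (lexp t (R \<circ> L \<circ> J) (R x))"
proof -
  define F where "F = R \<circ> L \<circ> J"
  have "bounded_linear F"
    unfolding F_def using assms(1-3) linear_compose linear_conv_bounded_linear by metis
  have krylov: "(L ^^ n) x \<in> V" for n
    by (rule funpow_mem_subspace_if_lexp_mem[OF assms(1,4,5)])
  have J_F_R: "J ((F ^^ n) (R x)) = (L ^^ n) x" for n
  proof (induction n)
    case 0
    show ?case using assms(6) krylov[of 0] by simp
  next
    case (Suc n)
    have "J ((F ^^ Suc n) (R x)) = J (R (L ((L ^^ n) x)))"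
      using Suc by (simp add: F_def comp_def)
    also have "\<dots> = (L ^^ Suc n) x" using assms(6) krylov[of "Suc n"] by simp
    finally show ?case .
  qed
  have "J (lexp t F (R x)) = (\<Sum>n. J ((t ^ n / fact n) *\<^sub>R (F ^^ n) (R x)))"
    unfolding lexp_def using assms(3) \<open>bounded_linear F\<close>
    by (intro bounded_linear.suminf lexp_summable) (simp_all add: linear_conv_bounded_linear)
  also have "\<dots> = lexp t L x"
    unfolding lexp_def using J_F_R linear_scale[OF assms(3)] by simp
  finally show ?thesis unfolding F_def by simp
qed

lemma lexp_mem_reach: "t \<ge> 0 \<Longrightarrow> \<rho>0 \<in> S \<Longrightarrow> lexp t L \<rho>0 \<in> reach L S"
  unfolding reach_def by (intro module.span_base[OF module_cscale]) blast

lemma dim_reach_le_card: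
  fixes J :: "complex^'m::finite \<Rightarrow> 'n::finite op"
  assumes "Vector_Spaces.linear (*s) cscale J"
    and "\<And>t \<rho>0. t \<ge> 0 \<Longrightarrow> \<rho>0 \<in> S \<Longrightarrow> lexp t L \<rho>0 \<in> range J"
  shows "vector_space.dim cscale (reach L S) \<le> CARD('m)"
proof -
  have "range J = module.span cscale (J ` cart_basis)"
    using module_hom.span_image[OF assms(1)[unfolded linear_iff_module_hom], of cart_basis]
    by (simp add: vec.span_Basis)
  then have "reach L S \<subseteq> module.span cscale (J ` cart_basis)"
    unfolding reach_def using assms(2)
    by (intro module.span_minimal[OF module_cscale] module.subspace_span[OF module_cscale]) auto
  then have "vector_space.dim cscale (reach L S) \<le> card (J ` cart_basis)"
    by (rule vector_space.dim_le_card[OF vector_space_cscale]) (simp add: vec.finite_Basis)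
  also have "\<dots> \<le> CARD('m)"
    using card_image_le[OF vec.finite_Basis, of J] by (simp add: card_cart_basis)
  finally show ?thesis .
qed

theorem theorem1:
  fixes A :: "'n::finite op set"
    and L :: "'n op \<Rightarrow> 'n op"
    and S V :: "'n op set"
    and P :: "'n op \<Rightarrow> 'n op"
    and R :: "'n op \<Rightarrow> complex^'k::finite"
    and J :: "complex^'k \<Rightarrow> 'n op"
  assumes "star_subalgebra A"
    and "is_lindblad L" and "L ` A \<subseteq> A"
    and "S \<subseteq> density_ops \<inter> A"
    and "module.subspace cscale V" and "reach L S \<subseteq> V"
    and "proj_factors V P R J"
  shows "(\<forall>t \<ge> 0. \<forall>\<rho>0 \<in> S. lexp t L \<rho>0 = J (lexp t (R \<circ> L \<circ> J) (R \<rho>0)))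
    \<and> (\<forall>(V'::'n op set) P' (R'::'n op \<Rightarrow> complex^'m::finite) J'.
          proj_factors V' P' R' J'
          \<and> (\<forall>t \<ge> 0. \<forall>\<rho>0 \<in> S. lexp t L \<rho>0 = J' (lexp t (R' \<circ> L \<circ> J') (R' \<rho>0)))
          \<longrightarrow> vector_space.dim cscale (reach L S) \<le> vector_space.dim cscale V')"
proof (intro conjI allI impI ballI)
  fix t :: real and \<rho>0
  assume "\<rho>0 \<in> S"
  from assms(7) have "P \<circ> P = P" "range P = V" "J \<circ> R = P"
    and R: "Vector_Spaces.linear cscale (*s) R" and J: "Vector_Spaces.linear (*s) cscale J"
    unfolding proj_factors_def by auto
  then have "J (R v) = v" if "v \<in> V" for v
    using that by (metis comp_apply rangeE)
  moreover have "lexp s L \<rho>0 \<in> V" if "s \<ge> 0" for s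
    using lexp_mem_reach[OF that \<open>\<rho>0 \<in> S\<close>] assms(6) by blast
  ultimately show "lexp t L \<rho>0 = J (lexp t (R \<circ> L \<circ> J) (R \<rho>0))"
    using lindblad_linear[OF assms(2)] subspace_if_cscale_subspace[OF assms(5)]
      linear_if_complex_linear[OF R scaleR_eq_cscale[symmetric] scaleR_eq_vector_scalar_mult[symmetric]]
      linear_if_complex_linear[OF J scaleR_eq_vector_scalar_mult[symmetric] scaleR_eq_cscale[symmetric]]
    by (intro lexp_factorization)
next
  fix V' P' and R' :: "'n op \<Rightarrow> complex^'m::finite" and J'
  assume reduced: "proj_factors V' P' R' J'
    \<and> (\<forall>t \<ge> 0. \<forall>\<rho>0 \<in> S. lexp t L \<rho>0 = J' (lexp t (R' \<circ> L \<circ> J') (R' \<rho>0)))"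
  then have "vector_space.dim cscale (reach L S) \<le> CARD('m)"
    by (intro dim_reach_le_card[where J = J']) (auto simp: proj_factors_def)
  then show "vector_space.dim cscale (reach L S) \<le> vector_space.dim cscale V'"
    using reduced by (simp add: proj_factors_def)
qed

end
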